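(* Let $T>0$, let $F^0,F^1,F^2:[0,T]\times\mathbb R\to\mathbb R$ be (deterministic) measurable functions, let $h^0,h^1,h^2,C^1,C^2\in\mathbb R$, and let $c^1,c^2$ be (deterministic) functions on $[0,T]$. Consider on $[0,T]$ the backward ODEs $$\mathbf y^0_t=h^0+\int_t^TF^0(s,\mathbf y^0_s)\,ds,\tag{1}$$ $$\mathbf y^1_t=h^1-C^1+\int_t^T[F^1(s,\mathbf y^1_s)+c^1_s]\,ds,\qquad\mathbf y^2_t=h^2+C^2+\int_t^T[F^2(s,\mathbf y_s^2)-c_s^2]\,ds.\tag{2}$$ Assume that: (i) $h^1\le h^0\le h^2$ and $F^1\le F^0\le F^2$; (ii) both ODEs in (2) admit bounded solutions $\mathbf y^1$ and $\mathbf y^2$ on $[0,T]$; (iii) for each $t\in[0,T]$, the functions $y\mapsto F^i(t,y)$, $i=0,1,2$, are uniformly Lipschitz continuous for $y\in[\mathbf y^1_t,\mathbf y^2_t]$, with a common Lipschitz constant $L$; (iv) for $i=1,2$, $C^i\ge\int_t^Te^{-\int_s^T\alpha_r\,dr}c^i_s\,ds$ for all $t\in[0,T]$ and all $\alpha$ satisfying $|\alpha|\le L$. Then (1) has a unique solution $\mathbf y^0$ satisfying $\mathbf y^1\le\mathbf y^0\le\mathbf y^2$.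
   Context: All functions are deterministic; $\alpha$ in (iv) ranges over measurable functions on $[0,T]$, and $c^1,c^2$ are integrable on $[0,T]$, so that the integrals make sense. *)

theory Defs
  imports "HOL-Analysis.Analysis"
begin

text \<open>Solutions on \<open>[0,T]\<close> of the backward equation \<open>y\<^sub>t = h + \<integral>\<^sub>t\<^sup>T G(s, y\<^sub>s) ds\<close>.
  Integrability is required explicitly, because the library's integral of a
  non-integrable function is \<open>0\<close>. Only the values of \<open>y\<close> on \<open>[0,T]\<close> matter.\<close>

definition backward_ode_solution ::
    "real \<Rightarrow> real \<Rightarrow> (real \<Rightarrow> real \<Rightarrow> real) \<Rightarrow> (real \<Rightarrow> real) \<Rightarrow> bool" where
  "backward_ode_solution T h G y \<longleftrightarrow>
     set_integrable lebesgue {0..T} (\<lambda>s. G s (y s)) \<and>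
     (\<forall>t\<in>{0..T}. y t = h + (LINT s:{t..T}|lebesgue. G s (y s)))"

end

theory Submission
  imports Defs
begin

text \<open>If \<open>p\<close> and \<open>q\<close> solve backward equations whose drivers are Lipschitz along \<open>p\<close>, \<open>q\<close>, then
  \<open>p - q\<close> solves a linear backward equation whose coefficient \<open>\<alpha>\<close>, a difference quotient of the
  driver, satisfies \<open>\<bar>\<alpha>\<bar> \<le> L\<close>. Its explicit solution by the integrating factor
  \<open>exp (- \<integral>\<^sub>t\<^sup>T \<alpha>)\<close> turns assumption (iv) into \<open>p \<ge> q\<close>. Applied to \<open>y\<^sup>2\<close> and \<open>y\<^sup>1\<close> this gives
  \<open>y\<^sup>1 \<le> y\<^sup>2\<close>. Composing \<open>F\<^sup>0\<close> with the projection onto \<open>[y\<^sup>1\<^sub>t, y\<^sup>2\<^sub>t]\<close> yields a globally Lipschitz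
  driver, for which Picard iteration produces a solution; comparing it with \<open>y\<^sup>1\<close> and \<open>y\<^sup>2\<close> shows
  that the projection never acts.

  All coefficients are merely integrable in time, so the integrating-factor formula cannot be
  checked by pointwise differentiation: the product rule is obtained from Fubini's theorem
  and the chain rule for \<open>exp\<close> from its power series.\<close>

section \<open>Product and chain rules for tail integrals; the linear equation\<close>

lemma absolutely_integrable_continuous_mult:
  fixes f g :: "real \<Rightarrow> real"
  assumes "continuous_on {a..b} f" "g absolutely_integrable_on {a..b}"
  shows "(\<lambda>x. f x * g x) absolutely_integrable_on {a..b}"
  by (rule absolutely_integrable_bounded_measurable_product_real)
    (use assms in \<open>auto intro: continuous_imp_measurable_on_sets_lebesgue compact_imp_bounded
      compact_continuous_image\<close>)

lemma continuous_on_upper_tail_integral: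
  fixes f :: "real \<Rightarrow> real"
  assumes "f absolutely_integrable_on {a..b}"
  shows "continuous_on {a..b} (\<lambda>t. integral {t..b} f)"
  using assms by (intro indefinite_integral_continuous_1') (rule set_lebesgue_integral_eq_integral)

text \<open>The left side is the integral of \<open>f s * g r\<close> over the square. Cutting the
  square along its diagonal and integrating each triangle by Fubini, innermost over the larger
  variable, gives the two terms on the right.\<close>

lemma integral_mult_integral_by_parts:
  fixes f g :: "real \<Rightarrow> real"
  assumes f: "f absolutely_integrable_on {a..b}" and g: "g absolutely_integrable_on {a..b}"
  shows "integral {a..b} f * integral {a..b} g =
    integral {a..b} (\<lambda>s. integral {s..b} g * f s) + integral {a..b} (\<lambda>s. integral {s..b} f * g s)"
proof -
  define M where "M = lebesgue_on {a..b}"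
  have fin: "finite_measure M"
    unfolding M_def by (intro finite_measure_lebesgue_on) auto
  interpret finite_measure M by (rule fin)
  interpret pair_sigma_finite M M ..
  have spM: "space M = {a..b}"
    by (simp add: M_def)
  have I: "integrable M f" "integrable M g"
    using f g by (simp_all add: M_def set_integrable_def integrable_restrict_space)
  have val: "(LINT x|M. h x) = integral {a..b} h" if "h absolutely_integrable_on {a..b}" for h :: "real \<Rightarrow> real"
    using set_lebesgue_integral_eq_integral(2)[OF that]
    by (simp add: M_def integral_restrict_space set_lebesgue_integral_def)
  \<comment> \<open>Makes the condition \<open>s \<le> r\<close> measurable on the product
    space.\<close>
  have idm [measurable]: "(\<lambda>x. x) \<in> borel_measurable M"
    unfolding M_def by (intro measurable_restrict_space1 measurable_completion) simp
  note [measurable] = I[THEN borel_measurable_integrable]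
  have H: "integrable (M \<Otimes>\<^sub>M M) (\<lambda>(s, r). f s * g r)"
  proof (rule Fubini_integrable)
    show "integrable M (\<lambda>x. LINT y|M. norm (case (x, y) of (s, r) \<Rightarrow> f s * g r))"
      using I by (simp add: abs_mult)
  qed (use I in auto)
  have H1: "integrable (M \<Otimes>\<^sub>M M) (\<lambda>(s, r). if s \<le> r then f s * g r else 0)"
    by (rule Bochner_Integration.integrable_bound[OF H]) auto
  have H2: "integrable (M \<Otimes>\<^sub>M M) (\<lambda>(s, r). if s \<le> r then 0 else f s * g r)"
    by (rule Bochner_Integration.integrable_bound[OF H]) auto
  have tail: "(LINT r|M. (if s \<le> r then h r else 0)) = integral {s..b} h"
    if "h absolutely_integrable_on {a..b}" "s \<in> {a..b}" for h :: "real \<Rightarrow> real" and s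
  proof -
    have "h absolutely_integrable_on {s..b}"
      using that by (auto intro: set_integrable_subset)
    then have "integral {s..b} h = (LINT r:{s..b}|lebesgue. h r)"
      by (simp add: set_lebesgue_integral_eq_integral)
    also have "\<dots> = (LINT r|M. (if s \<le> r then h r else 0))"
      using that by (auto simp: M_def integral_restrict_space set_lebesgue_integral_def
          indicator_def intro!: Bochner_Integration.integral_cong)
    finally show ?thesis by simp
  qed
  \<comment> \<open>The complementary triangle omits the diagonal: its sections differ from those in
    \<open>tail\<close> only at the point \<open>r = s\<close>, a null set.\<close>
  have tail': "(LINT r|M. (if r \<le> s then 0 else h r)) = integral {s..b} h"
    if h: "h absolutely_integrable_on {a..b}" and s: "s \<in> {a..b}" for h :: "real \<Rightarrow> real" and s
  proof -
    have [measurable]: "h \<in> borel_measurable M"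
      using h by (auto simp: M_def set_integrable_def integrable_restrict_space
        dest!: borel_measurable_integrable simp: borel_measurable_restrict_space_iff)
    have "AE r in lebesgue. r \<noteq> s"
      by (rule AE_completion) (rule AE_lborel_singleton)
    then have "AE r in M. r \<noteq> s"
      unfolding M_def by (subst AE_restrict_space_iff) auto
    then have ae: "AE r in M. (if r \<le> s then 0 else h r) = (if s \<le> r then h r else 0)"
      by eventually_elim auto
    have "(LINT r|M. (if r \<le> s then 0 else h r)) = (LINT r|M. (if s \<le> r then h r else 0))"
    proof (rule integral_cong_AE[OF _ _ ae])
      show "(\<lambda>r. if r \<le> s then 0 else h r) \<in> borel_measurable M"
        by measurable
      show "(\<lambda>r. if s \<le> r then h r else 0) \<in> borel_measurable M"
        by measurable
    qed
    then show ?thesis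
      using tail[OF h s] by simp
  qed
  have contf: "continuous_on {a..b} (\<lambda>s. integral {s..b} f)"
    and contg: "continuous_on {a..b} (\<lambda>s. integral {s..b} g)"
    using f g by (auto intro: continuous_on_upper_tail_integral)
  have "integral {a..b} f * integral {a..b} g = (LINT s|M. LINT r|M. f s * g r)"
    using f g by (simp add: val)
  also have "\<dots> = integral\<^sup>L (M \<Otimes>\<^sub>M M) (\<lambda>(s, r). f s * g r)"
    by (rule integral_fst[OF H])
  also have "\<dots> = integral\<^sup>L (M \<Otimes>\<^sub>M M) (\<lambda>p. (case p of (s, r) \<Rightarrow> if s \<le> r then f s * g r else 0) +
        (case p of (s, r) \<Rightarrow> if s \<le> r then 0 else f s * g r))"
    by (intro Bochner_Integration.integral_cong) auto
  also have "\<dots> = integral\<^sup>L (M \<Otimes>\<^sub>M M) (\<lambda>(s, r). if s \<le> r then f s * g r else 0) +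
        integral\<^sup>L (M \<Otimes>\<^sub>M M) (\<lambda>(s, r). if s \<le> r then 0 else f s * g r)"
    using H1 H2 by (rule Bochner_Integration.integral_add)
  also have "integral\<^sup>L (M \<Otimes>\<^sub>M M) (\<lambda>(s, r). if s \<le> r then f s * g r else 0) =
      (LINT s|M. LINT r|M. (if s \<le> r then f s * g r else 0))"
    by (rule integral_fst[OF H1, symmetric])
  also have "\<dots> = (LINT s|M. integral {s..b} g * f s)"
  proof (rule Bochner_Integration.integral_cong[OF refl])
    fix s assume "s \<in> space M"
    then have "(LINT r|M. (if s \<le> r then g r else 0)) = integral {s..b} g"
      using tail[OF g] spM by simp
    moreover have "(LINT r|M. (if s \<le> r then f s * g r else 0)) = (LINT r|M. f s * (if s \<le> r then g r else 0))"
      by (intro Bochner_Integration.integral_cong) auto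
    ultimately show "(LINT r|M. (if s \<le> r then f s * g r else 0)) = integral {s..b} g * f s"
      by simp
  qed
  \<comment> \<open>On \<open>r < s\<close> the inner variable has to be \<open>s\<close>, so that
    the inner interval is again a tail, \<open>{r..b}\<close>.\<close>
  also have "integral\<^sup>L (M \<Otimes>\<^sub>M M) (\<lambda>(s, r). if s \<le> r then 0 else f s * g r) =
      (LINT r|M. LINT s|M. (if s \<le> r then 0 else f s * g r))"
    by (rule integral_snd[OF H2, symmetric])
  also have "\<dots> = (LINT r|M. integral {r..b} f * g r)"
  proof (rule Bochner_Integration.integral_cong[OF refl])
    fix r assume "r \<in> space M"
    then have "(LINT s|M. (if s \<le> r then 0 else f s)) = integral {r..b} f"
      using tail'[OF f] spM by simp
    moreover have "(LINT s|M. (if s \<le> r then 0 else f s * g r)) = (LINT s|M. (if s \<le> r then 0 else f s) * g r)"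
      by (intro Bochner_Integration.integral_cong) auto
    ultimately show "(LINT s|M. (if s \<le> r then 0 else f s * g r)) = integral {r..b} f * g r"
      by simp
  qed
  finally show ?thesis
    using absolutely_integrable_continuous_mult[OF contg f] absolutely_integrable_continuous_mult[OF contf g]
    by (simp add: val)
qed

text \<open>Substitution rule for powers, by induction. Integration by parts of \<open>f\<close>
  against \<open>F ^ n * f\<close>, with \<open>F\<close> the tail integral of \<open>f\<close>,
  leaves two multiples of the integral of \<open>F ^ Suc n * f\<close>, with weights
  \<open>1 / (n + 1)\<close> and \<open>1\<close>; after multiplication by \<open>n + 1\<close> they
  add up to \<open>n + 2\<close>.\<close>

lemma power_tail_integral:
  fixes f :: "real \<Rightarrow> real"
  assumes f: "f absolutely_integrable_on {a..b}" and "t \<in> {a..b}"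
  shows "integral {t..b} f ^ Suc n = real (Suc n) * integral {t..b} (\<lambda>s. integral {s..b} f ^ n * f s)"
  using assms(2)
proof (induction n arbitrary: t)
  case 0
  then show ?case by simp
next
  case (Suc n)
  have ft: "f absolutely_integrable_on {t..b}"
    using f Suc.prems by (auto intro: set_integrable_subset)
  define F where "F s = integral {s..b} f" for s
  have cont: "continuous_on {t..b} (\<lambda>s. F s ^ k)" for k
    unfolding F_def by (intro continuous_intros continuous_on_upper_tail_integral ft)
  have int: "(\<lambda>s. F s ^ k * f s) absolutely_integrable_on {t..b}" for k
    by (rule absolutely_integrable_continuous_mult[OF cont ft])
  have IH: "F s ^ Suc n = real (Suc n) * integral {s..b} (\<lambda>s. F s ^ n * f s)" if "s \<in> {t..b}" for s
    using Suc.IH[of s] Suc.prems that by (simp add: F_def)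
  have "F t ^ Suc (Suc n) = real (Suc n) * (F t * integral {t..b} (\<lambda>s. F s ^ n * f s))"
    using IH[of t] Suc.prems by simp
  also have "F t * integral {t..b} (\<lambda>s. F s ^ n * f s) =
      integral {t..b} (\<lambda>s. integral {s..b} (\<lambda>s. F s ^ n * f s) * f s) +
      integral {t..b} (\<lambda>s. F s * (F s ^ n * f s))"
    using integral_mult_integral_by_parts[OF ft int] by (simp add: F_def)
  also have "integral {t..b} (\<lambda>s. integral {s..b} (\<lambda>s. F s ^ n * f s) * f s) =
      integral {t..b} (\<lambda>s. (1 / real (Suc n)) * (F s ^ Suc n * f s))"
    by (intro integral_cong) (simp add: IH field_simps del: power_Suc of_nat_Suc)
  also have "\<dots> = (1 / real (Suc n)) * integral {t..b} (\<lambda>s. F s ^ Suc n * f s)"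
    by (rule integral_mult_right)
  also have "real (Suc n) * (1 / real (Suc n) * integral {t..b} (\<lambda>s. F s ^ Suc n * f s) +
      integral {t..b} (\<lambda>s. F s * (F s ^ n * f s))) =
      real (Suc (Suc n)) * integral {t..b} (\<lambda>s. F s ^ Suc n * f s)"
    by (simp add: field_simps)
  finally show ?case by (simp add: F_def)
qed

text \<open>Integrated form of \<open>E' = E * f\<close>, \<open>E b = 1\<close>, for
  \<open>E s = exp (- integral {s..b} f)\<close>. The power rule handles each partial sum of the
  exponential series, and dominated convergence passes to the limit.\<close>

lemma exp_tail_integral:
  fixes f :: "real \<Rightarrow> real"
  assumes f: "f absolutely_integrable_on {a..b}" and "a \<le> b"
  shows "exp (- integral {a..b} f) = 1 - integral {a..b} (\<lambda>s. exp (- integral {s..b} f) * f s)"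
proof -
  define F where "F s = integral {s..b} f" for s
  have contF: "continuous_on {a..b} F"
    unfolding F_def by (intro continuous_on_upper_tail_integral f)
  obtain B where B: "\<forall>s\<in>{a..b}. \<bar>F s\<bar> \<le> B"
    using compact_imp_bounded[OF compact_continuous_image[OF contF compact_Icc]]
    by (auto simp: bounded_iff)
  define S where "S n x = (\<Sum>k<n. (- x) ^ k / fact k)" for n and x :: real
  have lim: "(\<lambda>n. S n x) \<longlonglongrightarrow> exp (- x)" for x
    using exp_converges[of "- x"] unfolding S_def sums_def by (simp add: divide_inverse mult.commute)
  \<comment> \<open>A bound independent of \<open>n\<close>, from which the dominating function
    \<open>exp B * \<bar>f s\<bar>\<close> is built.\<close>
  have bound: "\<bar>S n x\<bar> \<le> exp B" if "\<bar>x\<bar> \<le> B" for n x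
  proof -
    have "\<bar>S n x\<bar> \<le> (\<Sum>k<n. \<bar>x\<bar> ^ k / fact k)"
      unfolding S_def by (rule order_trans[OF sum_abs]) (simp add: power_abs)
    also have "\<dots> \<le> exp \<bar>x\<bar>"
      using exp_converges[of "\<bar>x\<bar>"]
      by (intro order_trans[OF sum_le_suminf[of "\<lambda>k. \<bar>x\<bar> ^ k / fact k"]])
        (auto simp: sums_iff divide_inverse mult.commute)
    finally show ?thesis using that by (meson exp_le_cancel_iff order_trans)
  qed
  have contS: "continuous_on {a..b} (\<lambda>s. S n (F s))" for n
    unfolding S_def by (intro continuous_intros contF) auto
  \<comment> \<open>Up to sign, integrating the term of index \<open>k\<close> against
    \<open>f\<close> gives the term of index \<open>k + 1\<close>. The first \<open>n\<close> terms
    thus produce \<open>S (Suc n)\<close> without its constant term \<open>1\<close>.\<close>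
  have step: "integral {a..b} (\<lambda>s. S n (F s) * f s) = 1 - S (Suc n) (F a)" for n
  proof -
    have int: "(\<lambda>s. (-1) ^ k / fact k * (F s ^ k * f s)) absolutely_integrable_on {a..b}" for k
      by (intro set_integrable_mult_right absolutely_integrable_continuous_mult f continuous_intros contF)
    have "integral {a..b} (\<lambda>s. S n (F s) * f s) =
        integral {a..b} (\<lambda>s. \<Sum>k<n. (-1) ^ k / fact k * (F s ^ k * f s))"
      by (intro integral_cong) (simp add: S_def sum_distrib_right sum_distrib_left power_minus[of "F _"] mult_ac)
    also have "\<dots> = (\<Sum>k<n. integral {a..b} (\<lambda>s. (-1) ^ k / fact k * (F s ^ k * f s)))"
      by (intro integral_sum) (use int set_lebesgue_integral_eq_integral(1) in auto)
    also have "\<dots> = (\<Sum>k<n. - ((- F a) ^ Suc k / fact (Suc k)))"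
    proof (rule sum.cong[OF refl])
      fix k
      have "F a ^ Suc k = real (Suc k) * integral {a..b} (\<lambda>s. F s ^ k * f s)"
        using power_tail_integral[OF f, of a k] \<open>a \<le> b\<close> by (simp add: F_def)
      then have "integral {a..b} (\<lambda>s. F s ^ k * f s) = F a ^ Suc k / real (Suc k)"
        by (simp add: field_simps del: of_nat_Suc)
      then show "integral {a..b} (\<lambda>s. (-1) ^ k / fact k * (F s ^ k * f s)) =
          - ((- F a) ^ Suc k / fact (Suc k))"
        by (simp add: power_minus[of "F a"] del: of_nat_Suc)
    qed
    also have "\<dots> = 1 - S (Suc n) (F a)"
      unfolding S_def by (subst sum.lessThan_Suc_shift) (simp add: sum_negf)
    finally show ?thesis .
  qed
  have "(\<lambda>n. integral {a..b} (\<lambda>s. S n (F s) * f s)) \<longlonglongrightarrow> integral {a..b} (\<lambda>s. exp (- F s) * f s)"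
  proof (rule dominated_convergence(2))
    show "(\<lambda>s. S n (F s) * f s) integrable_on {a..b}" for n
      by (intro set_lebesgue_integral_eq_integral(1) absolutely_integrable_continuous_mult contS f)
    show "(\<lambda>s. exp B * \<bar>f s\<bar>) integrable_on {a..b}"
      using f by (intro integrable_on_mult_right) (auto simp: absolutely_integrable_on_def)
    show "norm (S n (F s) * f s) \<le> exp B * \<bar>f s\<bar>" if "s \<in> {a..b}" for n s
      using bound[of "F s" n] B that by (simp add: abs_mult mult_right_mono)
    show "(\<lambda>n. S n (F s) * f s) \<longlonglongrightarrow> exp (- F s) * f s" for s
      by (intro tendsto_intros lim)
  qed
  moreover have "(\<lambda>n. integral {a..b} (\<lambda>s. S n (F s) * f s)) \<longlonglongrightarrow> 1 - exp (- F a)"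
    unfolding step by (intro tendsto_intros LIMSEQ_Suc lim)
  ultimately show ?thesis
    using LIMSEQ_unique unfolding F_def by fastforce
qed

text \<open>Variation of constants: formally \<open>D' = - (f * D + g)\<close> and
  \<open>E' = E * f\<close> for the integrating factor \<open>E\<close>, so
  \<open>(D * E)' = - E * g\<close>. Rigorously, integration by parts is applied to
  \<open>u = f * D + g\<close> and \<open>v = E * f\<close>, whose tail integrals are
  \<open>D s - d\<close> and \<open>1 - E s\<close>.\<close>

lemma linear_backward_ode_solution_formula:
  fixes f g D :: "real \<Rightarrow> real"
  assumes f: "f absolutely_integrable_on {a..b}" and g: "g absolutely_integrable_on {a..b}"
    and D: "\<And>t. t \<in> {a..b} \<Longrightarrow> D t = d + integral {t..b} (\<lambda>s. f s * D s + g s)"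
    and cont: "continuous_on {a..b} D" and ab: "a \<le> b"
  shows "D a * exp (- integral {a..b} f) =
    d + integral {a..b} (\<lambda>s. exp (- integral {s..b} f) * g s)"
proof -
  define E where "E s = exp (- integral {s..b} f)" for s
  define u where "u = (\<lambda>s. f s * D s + g s)"
  define v where "v = (\<lambda>s. E s * f s)"
  have fD: "(\<lambda>s. f s * D s) absolutely_integrable_on {a..b}"
    using absolutely_integrable_continuous_mult[OF cont f] by (simp add: mult.commute)
  have u: "u absolutely_integrable_on {a..b}"
    unfolding u_def by (intro set_integral_add fD g)
  have contE: "continuous_on {a..b} E"
    unfolding E_def by (intro continuous_intros continuous_on_upper_tail_integral f)
  have v: "v absolutely_integrable_on {a..b}"
    unfolding v_def by (intro absolutely_integrable_continuous_mult contE f)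
  have E: "E t = 1 - integral {t..b} v" if "t \<in> {a..b}" for t
    unfolding E_def v_def
    by (intro exp_tail_integral set_integrable_subset[OF f]) (use that in auto)
  have Du: "D t = d + integral {t..b} u" if "t \<in> {a..b}" for t
    using D[OF that] by (simp add: u_def)
  note int = set_lebesgue_integral_eq_integral(1)
  have Ig: "(\<lambda>s. E s * g s) absolutely_integrable_on {a..b}"
    and Iu: "(\<lambda>s. E s * u s) absolutely_integrable_on {a..b}"
    and Iv: "(\<lambda>s. D s * v s) absolutely_integrable_on {a..b}"
    by (intro absolutely_integrable_continuous_mult contE cont g u v)+
  have "integral {a..b} u * integral {a..b} v =
      integral {a..b} (\<lambda>s. integral {s..b} v * u s) + integral {a..b} (\<lambda>s. integral {s..b} u * v s)"
    by (rule integral_mult_integral_by_parts[OF u v])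
  also have "integral {a..b} (\<lambda>s. integral {s..b} v * u s) = integral {a..b} (\<lambda>s. u s - E s * u s)"
    by (intro integral_cong) (simp add: E algebra_simps)
  also have "\<dots> = integral {a..b} u - integral {a..b} (\<lambda>s. E s * u s)"
    by (intro integral_diff int u Iu)
  also have "integral {a..b} (\<lambda>s. integral {s..b} u * v s) = integral {a..b} (\<lambda>s. D s * v s - d * v s)"
    by (intro integral_cong) (simp add: Du algebra_simps)
  also have "\<dots> = integral {a..b} (\<lambda>s. D s * v s) - d * integral {a..b} v"
    by (subst integral_diff) (auto intro!: int Iv v integrable_on_mult_right)
  finally have uv: "integral {a..b} u * integral {a..b} v = integral {a..b} u
      - integral {a..b} (\<lambda>s. E s * u s) + (integral {a..b} (\<lambda>s. D s * v s) - d * integral {a..b} v)" .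
  \<comment> \<open>Since \<open>D * v = E * f * D\<close>, subtracting it from \<open>E * u\<close>
    leaves the source term. The integrals on the right are then eliminated with \<open>uv\<close>,
    where \<open>u\<close> and \<open>v\<close> integrate to \<open>D a - d\<close> and
    \<open>1 - E a\<close>.\<close>
  have "integral {a..b} (\<lambda>s. E s * g s) = integral {a..b} (\<lambda>s. E s * u s - D s * v s)"
    by (intro integral_cong) (simp add: u_def v_def algebra_simps)
  also have "\<dots> = integral {a..b} (\<lambda>s. E s * u s) - integral {a..b} (\<lambda>s. D s * v s)"
    by (intro integral_diff int Iu Iv)
  finally have "D a * E a = d + integral {a..b} (\<lambda>s. E s * g s)"
    using uv ab by (simp add: Du E algebra_simps)
  then show ?thesis
    by (simp add: E_def)
qed

section \<open>Measurability along paths and the difference of two solutions\<close>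

lemma borel_measurable_lebesgue_on_if_borel:
  assumes "f \<in> borel_measurable (restrict_space borel S)" "S \<in> sets borel"
  shows "(f :: real \<Rightarrow> real) \<in> borel_measurable (lebesgue_on S)"
proof -
  have "(\<lambda>x. indicator S x *\<^sub>R f x) \<in> borel_measurable borel"
    using assms by (subst (asm) borel_measurable_restrict_space_iff) auto
  then have "(\<lambda>x. indicator S x *\<^sub>R f x) \<in> borel_measurable lebesgue"
    by (intro measurable_completion) simp
  then show ?thesis
    using assms(2) by (subst borel_measurable_restrict_space_iff) auto
qed

text \<open>The graph map \<open>s \<mapsto> (s, y s)\<close> is continuous on \<open>S\<close>,
  hence Borel, and composes with the jointly Borel \<open>F\<close>. The result stays Borel, as is
  required of the coefficients \<open>\<alpha>\<close> in the bounds on \<open>C1\<close> and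
  \<open>C2\<close>.\<close>

lemma borel_measurable_compose_continuous_graph:
  fixes F :: "real \<Rightarrow> real \<Rightarrow> real"
  assumes F: "(\<lambda>(t, y). F t y) \<in> borel_measurable (restrict_space borel (S \<times> UNIV))"
    and y: "continuous_on S y"
  shows "(\<lambda>s. F s (y s)) \<in> borel_measurable (restrict_space borel S)"
proof -
  have "(\<lambda>s. (s, y s)) \<in> restrict_space borel S \<rightarrow>\<^sub>M restrict_space borel (S \<times> UNIV)"
    by (intro measurable_restrict_space2 borel_measurable_continuous_on_restrict continuous_intros y)
      (auto simp: space_restrict_space)
  from measurable_compose[OF this F] show ?thesis
    by simp
qed

text \<open>\<open>P\<close> and \<open>Q\<close> stand for one driver evaluated along
  \<open>p\<close> and \<open>q\<close>; \<open>\<gamma>\<close> and \<open>\<delta>\<close> collect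
  all other terms. Since \<open>P - Q = \<alpha> * (p - q)\<close>, the difference
  \<open>p - q\<close> solves a linear equation with coefficient \<open>\<alpha>\<close> and source
  \<open>\<gamma> - \<delta>\<close>.\<close>

lemma backward_difference_formula:
  fixes p q P Q \<gamma> \<delta> :: "real \<Rightarrow> real"
  assumes meas: "P \<in> borel_measurable (restrict_space borel {a..b})"
      "Q \<in> borel_measurable (restrict_space borel {a..b})"
    and int: "P absolutely_integrable_on {a..b}" "Q absolutely_integrable_on {a..b}"
      "\<gamma> absolutely_integrable_on {a..b}" "\<delta> absolutely_integrable_on {a..b}"
    and cont: "continuous_on {a..b} p" "continuous_on {a..b} q"
    and lip: "\<And>s. s \<in> {a..b} \<Longrightarrow> \<bar>P s - Q s\<bar> \<le> L * \<bar>p s - q s\<bar>"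
    and p: "\<And>t. t \<in> {a..b} \<Longrightarrow> p t = hp + integral {t..b} (\<lambda>s. P s + \<gamma> s)"
    and q: "\<And>t. t \<in> {a..b} \<Longrightarrow> q t = hq + integral {t..b} (\<lambda>s. Q s + \<delta> s)"
    and L: "0 \<le> L"
  obtains \<alpha> where "\<alpha> \<in> borel_measurable (restrict_space borel {a..b})"
    "\<forall>r\<in>{a..b}. \<bar>\<alpha> r\<bar> \<le> L" "\<alpha> absolutely_integrable_on {a..b}"
    "\<And>t. t \<in> {a..b} \<Longrightarrow> (p t - q t) * exp (- integral {t..b} \<alpha>) =
      hp - hq + integral {t..b} (\<lambda>s. exp (- integral {s..b} \<alpha>) * (\<gamma> s - \<delta> s))"
proof -
  \<comment> \<open>Division by zero gives \<open>0\<close>, the value wanted where \<open>p\<close> and \<open>q\<close> agree.\<close>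
  define \<alpha> where "\<alpha> s = (P s - Q s) / (p s - q s)" for s
  have [measurable]: "p \<in> borel_measurable (restrict_space borel {a..b})"
      "q \<in> borel_measurable (restrict_space borel {a..b})"
    by (intro borel_measurable_continuous_on_restrict cont)+
  note [measurable] = meas
  have \<alpha>_meas: "\<alpha> \<in> borel_measurable (restrict_space borel {a..b})"
    unfolding \<alpha>_def by measurable
  have \<alpha>_bound: "\<bar>\<alpha> r\<bar> \<le> L" if "r \<in> {a..b}" for r
  proof (cases "p r = q r")
    case False
    then show ?thesis
      using lip[OF that] by (simp add: \<alpha>_def field_simps)
  qed (use L in \<open>simp add: \<alpha>_def\<close>)
  have \<alpha>_int: "\<alpha> absolutely_integrable_on {a..b}"
    by (rule measurable_bounded_by_integrable_imp_absolutely_integrable[where g = "\<lambda>_. L"])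
      (use \<alpha>_bound borel_measurable_lebesgue_on_if_borel[OF \<alpha>_meas] in auto)
  note sub = set_integrable_subset[of _ "{a..b}"]
  note ign = set_lebesgue_integral_eq_integral(1)
  have D: "p t - q t = (hp - hq) + integral {t..b} (\<lambda>s. \<alpha> s * (p s - q s) + (\<gamma> s - \<delta> s))"
    if t: "t \<in> {a..b}" for t
  proof -
    have "(\<lambda>s. P s + \<gamma> s) absolutely_integrable_on {t..b}" "(\<lambda>s. Q s + \<delta> s) absolutely_integrable_on {t..b}"
      using t by (auto intro!: sub set_integral_add int)
    then have "integral {t..b} (\<lambda>s. P s + \<gamma> s) - integral {t..b} (\<lambda>s. Q s + \<delta> s) =
        integral {t..b} (\<lambda>s. (P s + \<gamma> s) - (Q s + \<delta> s))"
      by (intro integral_diff[symmetric] ign)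
    also have "\<dots> = integral {t..b} (\<lambda>s. \<alpha> s * (p s - q s) + (\<gamma> s - \<delta> s))"
    proof (rule integral_cong)
      fix s assume "s \<in> {t..b}"
      \<comment> \<open>Where \<open>p s = q s\<close>, the Lipschitz bound forces
        \<open>P s = Q s\<close>, so both sides vanish.\<close>
      then have "P s - Q s = \<alpha> s * (p s - q s)"
        using lip[of s] t by (cases "p s = q s") (auto simp: \<alpha>_def)
      then show "(P s + \<gamma> s) - (Q s + \<delta> s) = \<alpha> s * (p s - q s) + (\<gamma> s - \<delta> s)"
        by simp
    qed
    finally show ?thesis
      using p[OF t] q[OF t] by simp
  qed
  have "(p t - q t) * exp (- integral {t..b} \<alpha>) =
      hp - hq + integral {t..b} (\<lambda>s. exp (- integral {s..b} \<alpha>) * (\<gamma> s - \<delta> s))"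
    if t: "t \<in> {a..b}" for t
  proof (rule linear_backward_ode_solution_formula)
    show "\<alpha> absolutely_integrable_on {t..b}" "(\<lambda>s. \<gamma> s - \<delta> s) absolutely_integrable_on {t..b}"
      using t by (auto intro!: sub \<alpha>_int set_integral_diff int)
    show "continuous_on {t..b} (\<lambda>t. p t - q t)"
      using t by (auto intro!: continuous_intros continuous_on_subset[OF cont(1)] continuous_on_subset[OF cont(2)])
    show "p t' - q t' = hp - hq + integral {t'..b} (\<lambda>s. \<alpha> s * (p s - q s) + (\<gamma> s - \<delta> s))"
      if "t' \<in> {t..b}" for t'
      using D[of t'] t that by simp
  qed (use t in auto)
  with \<alpha>_meas \<alpha>_bound \<alpha>_int show ?thesis
    by (intro that[of \<alpha>]) auto
qed

section \<open>Existence for globally Lipschitz drivers\<close>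

lemma backward_ode_exists_of_lipschitz:
  fixes G :: "real \<Rightarrow> real \<Rightarrow> real"
  assumes lip: "\<And>s x y. s \<in> {a..b} \<Longrightarrow> \<bar>G s x - G s y\<bar> \<le> L * \<bar>x - y\<bar>"
    and int: "\<And>y. continuous_on {a..b} y \<Longrightarrow> (\<lambda>s. G s (y s)) absolutely_integrable_on {a..b}"
    and ab: "a \<le> b" and L: "0 \<le> L"
  shows "\<exists>y. continuous_on {a..b} y \<and>
    (\<forall>t\<in>{a..b}. y t = h + integral {t..b} (\<lambda>s. G s (y s)))"
proof -
  \<comment> \<open>Picard iteration for \<open>u = y / e\<close>; the exponential weight makes it a contraction on all of \<open>{a..b}\<close>.\<close>
  define K where "K = 2 * L + 1"
  define e where "e s = exp (K * (b - s))" for s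
  \<comment> \<open>\<open>L / K\<close> will be the contraction factor. Any \<open>K > L\<close>
    would do; the summand \<open>1\<close> covers the case \<open>L = 0\<close>.\<close>
  have K: "K > 0" "L / K < 1" "0 \<le> L / K"
    using L by (auto simp: K_def field_simps)
  have e_pos: "e s > 0" for s
    by (simp add: e_def)
  have e_cont: "continuous_on S e" for S
    unfolding e_def by (intro continuous_intros)
  have e_int: "(e has_integral (e t - 1) / K) {t..b}" if "t \<in> {a..b}" for t
  proof -
    have "(e has_integral (- e b / K - (- e t / K))) {t..b}"
      by (rule fundamental_theorem_of_calculus)
        (use that K in \<open>auto simp: e_def has_real_derivative_iff_has_vector_derivative[symmetric]
          intro!: derivative_eq_intros\<close>)
    then show ?thesis
      using K by (simp add: e_def diff_divide_distrib)
  qed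
  define \<Psi> where "\<Psi> u t = (h + integral {t..b} (\<lambda>s. G s (e s * apply_bcontfun u s))) / e t" for u t
  have Gint: "(\<lambda>s. G s (e s * apply_bcontfun u s)) absolutely_integrable_on {a..b}" for u
    by (intro int continuous_intros e_cont) auto
  have \<Psi>_cont: "continuous_on {a..b} (\<Psi> u)" for u
    unfolding \<Psi>_def using e_pos
    by (intro continuous_intros continuous_on_upper_tail_integral Gint e_cont) (auto simp: less_imp_neq[symmetric])
  \<comment> \<open>Clamping the argument extends \<open>\<Psi> u\<close> to a bounded continuous
    function on the line, so the fixed point can be sought in the complete space of such
    functions.\<close>
  have "\<exists>v. \<forall>x. apply_bcontfun v x = \<Psi> u (clamp a b x)" for u
    using continuous_on_cbox_bcontfunE[of a b "\<Psi> u"] \<Psi>_cont by (metis box_real(2) ext_cont_def)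
  then obtain \<Phi> where \<Phi>: "\<And>u x. apply_bcontfun (\<Phi> u) x = \<Psi> u (clamp a b x)"
    by metis
  \<comment> \<open>The difference of the drivers at \<open>s\<close> is at most
    \<open>L * dist u v * e s\<close>. Integrating \<open>e\<close> over \<open>{t..b}\<close> gives
    at most \<open>e t / K\<close>, and the division by \<open>e t\<close> in \<open>\<Psi>\<close>
    leaves \<open>L / K\<close>.\<close>
  have contr: "dist (\<Psi> u t) (\<Psi> v t) \<le> L / K * dist u v" if t: "t \<in> {a..b}" for u v t
  proof -
    have I: "(\<lambda>s. G s (e s * apply_bcontfun w s)) integrable_on {t..b}" for w
      using t by (intro set_lebesgue_integral_eq_integral(1) set_integrable_subset[OF Gint]) auto
    have "\<bar>integral {t..b} (\<lambda>s. G s (e s * u s)) - integral {t..b} (\<lambda>s. G s (e s * v s))\<bar> =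
       norm (integral {t..b} (\<lambda>s. G s (e s * u s) - G s (e s * v s)))"
      by (simp add: integral_diff I)
    also have "\<dots> \<le> integral {t..b} (\<lambda>s. (L * dist u v) * e s)"
    proof (rule integral_norm_bound_integral)
      show "(\<lambda>s. G s (e s * u s) - G s (e s * v s)) integrable_on {t..b}"
        by (intro integrable_diff I)
      show "(\<lambda>s. (L * dist u v) * e s) integrable_on {t..b}"
        using e_int[OF t] by (intro integrable_on_mult_right) auto
      fix s assume "s \<in> {t..b}"
      then have "\<bar>G s (e s * u s) - G s (e s * v s)\<bar> \<le> L * \<bar>e s * u s - e s * v s\<bar>"
        using t by (intro lip) auto
      also have "\<bar>e s * u s - e s * v s\<bar> = e s * dist (u s) (v s)"
        using e_pos[of s] by (simp add: right_diff_distrib[symmetric] abs_mult dist_real_def)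
      also have "L * \<dots> \<le> L * (e s * dist u v)"
        using L e_pos[of s] by (intro mult_left_mono dist_bounded) auto
      finally show "norm (G s (e s * u s) - G s (e s * v s)) \<le> (L * dist u v) * e s"
        by (simp add: mult_ac)
    qed
    also have "\<dots> = (L * dist u v) * ((e t - 1) / K)"
      using integral_unique[OF e_int[OF t]] by simp
    also have "\<dots> \<le> (L * dist u v) * (e t / K)"
      using L K by (intro mult_left_mono divide_right_mono) auto
    finally have *: "\<bar>integral {t..b} (\<lambda>s. G s (e s * u s)) - integral {t..b} (\<lambda>s. G s (e s * v s))\<bar> \<le>
        (L * dist u v) * (e t / K)" .
    have "dist (\<Psi> u t) (\<Psi> v t) =
        \<bar>integral {t..b} (\<lambda>s. G s (e s * u s)) - integral {t..b} (\<lambda>s. G s (e s * v s))\<bar> / e t"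
      using e_pos[of t] by (simp add: \<Psi>_def dist_real_def diff_divide_distrib[symmetric] abs_divide)
    also have "\<dots> \<le> (L * dist u v) * (e t / K) / e t"
      using * e_pos[of t] by (intro divide_right_mono) auto
    finally show ?thesis
      using e_pos[of t] by (simp add: mult_ac)
  qed
  have "\<exists>!u. \<Phi> u = u"
  proof (rule banach_fix_type)
    show "\<forall>x y. dist (\<Phi> x) (\<Phi> y) \<le> L / K * dist x y"
    proof (intro allI dist_bound)
      fix u v x
      have "clamp a b x \<in> {a..b}"
        using clamp_in_interval[of a b x] ab by simp
      then show "dist (\<Phi> u x) (\<Phi> v x) \<le> L / K * dist u v"
        by (simp only: \<Phi> contr)
    qed
  qed (use K in auto)
  then obtain u where u: "\<Phi> u = u"
    by blast
  have "u t = \<Psi> u t" if "t \<in> {a..b}" for t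
    using \<Phi>[of u t] u clamp_cancel_cbox[of t a b] that by simp
  then have "e t * u t = h + integral {t..b} (\<lambda>s. G s (e s * u s))" if "t \<in> {a..b}" for t
    using that e_pos[of t] unfolding \<Psi>_def by (simp add: field_simps)
  moreover have "continuous_on {a..b} (\<lambda>t. e t * u t)"
    by (intro continuous_intros e_cont) auto
  ultimately show ?thesis
    by (intro exI[of _ "\<lambda>t. e t * u t"]) auto
qed

section \<open>Integral form and continuity of solutions\<close>

lemma backward_ode_solution_iff_integral:
  assumes "(\<lambda>s. G s (y s)) absolutely_integrable_on {0..T}"
  shows "backward_ode_solution T h G y \<longleftrightarrow> (\<forall>t\<in>{0..T}. y t = h + integral {t..T} (\<lambda>s. G s (y s)))"
proof -
  have "(LINT s:{t..T}|lebesgue. G s (y s)) = integral {t..T} (\<lambda>s. G s (y s))" if "t \<in> {0..T}" for t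
    using that by (intro set_lebesgue_integral_eq_integral(2) set_integrable_subset[OF assms]) auto
  then show ?thesis
    using assms by (simp add: backward_ode_solution_def)
qed

lemma backward_ode_solutionD:
  assumes "backward_ode_solution T h G y"
  shows "(\<lambda>s. G s (y s)) absolutely_integrable_on {0..T}"
    and "\<And>t. t \<in> {0..T} \<Longrightarrow> y t = h + integral {t..T} (\<lambda>s. G s (y s))"
    and "continuous_on {0..T} y"
proof -
  show int: "(\<lambda>s. G s (y s)) absolutely_integrable_on {0..T}"
    using assms by (simp add: backward_ode_solution_def)
  show y: "y t = h + integral {t..T} (\<lambda>s. G s (y s))" if "t \<in> {0..T}" for t
    using assms backward_ode_solution_iff_integral[where G = G, OF int] that by blast
  have "continuous_on {0..T} (\<lambda>t. h + integral {t..T} (\<lambda>s. G s (y s)))"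
    by (intro continuous_intros continuous_on_upper_tail_integral int)
  then show "continuous_on {0..T} y"
    by (subst continuous_on_cong[OF refl y])
qed

section \<open>Existence and uniqueness between \<open>y1\<close> and \<open>y2\<close>\<close>

theorem lemma5p1:
  fixes T L h0 h1 h2 C1 C2 :: real
    and F0 F1 F2 :: "real \<Rightarrow> real \<Rightarrow> real"
    and c1 c2 y1 y2 :: "real \<Rightarrow> real"
  assumes T: "T > 0"
    and F0_meas: "(\<lambda>(t, y). F0 t y) \<in> borel_measurable (restrict_space borel ({0..T} \<times> UNIV))"
    and F1_meas: "(\<lambda>(t, y). F1 t y) \<in> borel_measurable (restrict_space borel ({0..T} \<times> UNIV))"
    and F2_meas: "(\<lambda>(t, y). F2 t y) \<in> borel_measurable (restrict_space borel ({0..T} \<times> UNIV))"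
    and c1_int: "set_integrable lebesgue {0..T} c1"
    and c2_int: "set_integrable lebesgue {0..T} c2"
    and h_le: "h1 \<le> h0" "h0 \<le> h2"
    and F_le: "\<And>t y. t \<in> {0..T} \<Longrightarrow> F1 t y \<le> F0 t y \<and> F0 t y \<le> F2 t y"
    and y1_sol: "backward_ode_solution T (h1 - C1) (\<lambda>s y. F1 s y + c1 s) y1"
    and y1_bdd: "bounded (y1 ` {0..T})"
    and y2_sol: "backward_ode_solution T (h2 + C2) (\<lambda>s y. F2 s y - c2 s) y2"
    and y2_bdd: "bounded (y2 ` {0..T})"
    and Lip: "\<And>t. t \<in> {0..T} \<Longrightarrow>
          L-lipschitz_on (closed_segment (y1 t) (y2 t)) (F0 t) \<and>
          L-lipschitz_on (closed_segment (y1 t) (y2 t)) (F1 t) \<and>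
          L-lipschitz_on (closed_segment (y1 t) (y2 t)) (F2 t)"
    and C_ge: "\<And>t \<alpha>. t \<in> {0..T} \<Longrightarrow> \<alpha> \<in> borel_measurable (restrict_space borel {0..T}) \<Longrightarrow>
          (\<forall>r\<in>{0..T}. \<bar>\<alpha> r\<bar> \<le> L) \<Longrightarrow>
          C1 \<ge> (LINT s:{t..T}|lebesgue. exp (- (LINT r:{s..T}|lebesgue. \<alpha> r)) * c1 s) \<and>
          C2 \<ge> (LINT s:{t..T}|lebesgue. exp (- (LINT r:{s..T}|lebesgue. \<alpha> r)) * c2 s)"
  shows "\<exists>y0. (backward_ode_solution T h0 F0 y0 \<and> (\<forall>t\<in>{0..T}. y1 t \<le> y0 t \<and> y0 t \<le> y2 t)) \<and>
          (\<forall>z. backward_ode_solution T h0 F0 z \<and> (\<forall>t\<in>{0..T}. y1 t \<le> z t \<and> z t \<le> y2 t) \<longrightarrow>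
               (\<forall>t\<in>{0..T}. z t = y0 t))"
proof -
  let ?I = "{0..T}"
  have L: "0 \<le> L"
    using Lip[of 0] T by (auto intro: lipschitz_on_nonneg)
  note y1 = backward_ode_solutionD[OF y1_sol] and y2 = backward_ode_solutionD[OF y2_sol]
  note comp = borel_measurable_compose_continuous_graph
  note add = set_integral_add(1) and diff = set_integral_diff(1)
  note ign = set_lebesgue_integral_eq_integral(1)
  have norm_int: "(\<lambda>s. \<bar>f s\<bar>) integrable_on ?I" if "f absolutely_integrable_on ?I" for f :: "real \<Rightarrow> real"
    using that by (simp add: absolutely_integrable_on_def)
  have F11: "(\<lambda>s. F1 s (y1 s)) absolutely_integrable_on ?I"
    using diff[OF y1(1) c1_int] by simp
  have F22: "(\<lambda>s. F2 s (y2 s)) absolutely_integrable_on ?I"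
    using add[OF y2(1) c2_int] by simp
  \<comment> \<open>The order of \<open>y1 t\<close> and \<open>y2 t\<close> is still unknown here;
    \<open>closed_segment\<close> contains both endpoints whichever is larger.\<close>
  have lip: "\<bar>F t x - F t y\<bar> \<le> L * \<bar>x - y\<bar>"
    if "t \<in> ?I" "F = F0 \<or> F = F1 \<or> F = F2"
      "x \<in> closed_segment (y1 t) (y2 t)" "y \<in> closed_segment (y1 t) (y2 t)" for F t x y
    using that Lip[OF that(1)] lipschitz_onD[of L _ "F t" x y] by (auto simp: dist_real_def)
  \<comment> \<open>The equations give integrability of \<open>F2\<close> along \<open>y2\<close>
    only; the Lipschitz bound carries it over to \<open>y1\<close>.\<close>
  have F21: "(\<lambda>s. F2 s (y1 s)) absolutely_integrable_on ?I"
  proof (rule measurable_bounded_by_integrable_imp_absolutely_integrable)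
    show "(\<lambda>s. F2 s (y1 s)) \<in> borel_measurable (lebesgue_on ?I)"
      by (intro borel_measurable_lebesgue_on_if_borel comp F2_meas y1) auto
    show "(\<lambda>s. \<bar>F2 s (y2 s)\<bar> + L * \<bar>y1 s - y2 s\<bar>) integrable_on ?I"
      by (intro integrable_add[OF norm_int[OF F22]] integrable_continuous_real continuous_intros y1 y2)
    show "norm (F2 s (y1 s)) \<le> \<bar>F2 s (y2 s)\<bar> + L * \<bar>y1 s - y2 s\<bar>" if "s \<in> ?I" for s
      using lip[OF that, of F2 "y1 s" "y2 s"] by simp
  qed auto
  have lower: "integral {t..T} (\<lambda>s. exp (- integral {s..T} \<alpha>) * c1 s) \<le> C1"
      "integral {t..T} (\<lambda>s. exp (- integral {s..T} \<alpha>) * c2 s) \<le> C2"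
      "continuous_on {t..T} (\<lambda>s. exp (- integral {s..T} \<alpha>))"
    if t: "t \<in> ?I" and \<alpha>: "\<alpha> \<in> borel_measurable (restrict_space borel ?I)"
      "\<forall>r\<in>?I. \<bar>\<alpha> r\<bar> \<le> L" "\<alpha> absolutely_integrable_on ?I" for t \<alpha>
  proof -
    have cont: "continuous_on ?I (\<lambda>s. exp (- integral {s..T} \<alpha>))"
      by (intro continuous_intros continuous_on_upper_tail_integral \<alpha>)
    then show "continuous_on {t..T} (\<lambda>s. exp (- integral {s..T} \<alpha>))"
      using t by (auto intro: continuous_on_subset)
    have in_eq: "(LINT r:{s..T}|lebesgue. \<alpha> r) = integral {s..T} \<alpha>" if "s \<in> {t..T}" for s
      using that t by (intro set_lebesgue_integral_eq_integral(2) set_integrable_subset[OF \<alpha>(3)]) auto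
    have "(LINT s:{t..T}|lebesgue. exp (- (LINT r:{s..T}|lebesgue. \<alpha> r)) * c s) =
        integral {t..T} (\<lambda>s. exp (- integral {s..T} \<alpha>) * c s)"
      if "set_integrable lebesgue ?I c" for c :: "real \<Rightarrow> real"
    proof -
      have "(LINT s:{t..T}|lebesgue. exp (- (LINT r:{s..T}|lebesgue. \<alpha> r)) * c s) =
          (LINT s:{t..T}|lebesgue. exp (- integral {s..T} \<alpha>) * c s)"
        by (intro set_lebesgue_integral_cong) (auto simp: in_eq)
      also have "\<dots> = integral {t..T} (\<lambda>s. exp (- integral {s..T} \<alpha>) * c s)"
        using t by (intro set_lebesgue_integral_eq_integral(2)
            set_integrable_subset[OF absolutely_integrable_continuous_mult[OF cont that]]) auto
      finally show ?thesis .
    qed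
    from this[OF c1_int] this[OF c2_int] C_ge[OF t \<alpha>(1,2)]
    show "integral {t..T} (\<lambda>s. exp (- integral {s..T} \<alpha>) * c1 s) \<le> C1"
      "integral {t..T} (\<lambda>s. exp (- integral {s..T} \<alpha>) * c2 s) \<le> C2"
      by auto
  qed
  \<comment> \<open>One comparison serves four times. The switches \<open>k1\<close>,
    \<open>k2\<close> select which bounds on \<open>C1\<close>, \<open>C2\<close> are spent: both
    for \<open>y1 \<le> y2\<close>, the first for \<open>y1 \<le> y0\<close>, the second for
    \<open>y0 \<le> y2\<close>, none for uniqueness.\<close>
  have compare: "q t \<le> p t"
    if t: "t \<in> ?I"
      and pq: "P \<in> borel_measurable (restrict_space borel ?I)" "Q \<in> borel_measurable (restrict_space borel ?I)"
      "P absolutely_integrable_on ?I" "Q absolutely_integrable_on ?I"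
      "\<gamma> absolutely_integrable_on ?I" "\<delta> absolutely_integrable_on ?I"
      "continuous_on ?I p" "continuous_on ?I q"
      "\<And>s. s \<in> ?I \<Longrightarrow> \<bar>P s - Q s\<bar> \<le> L * \<bar>p s - q s\<bar>"
      "\<And>t. t \<in> ?I \<Longrightarrow> p t = hp + integral {t..T} (\<lambda>s. P s + \<gamma> s)"
      "\<And>t. t \<in> ?I \<Longrightarrow> q t = hq + integral {t..T} (\<lambda>s. Q s + \<delta> s)"
      and k: "k1 \<in> {0, 1}" "k2 \<in> {0, 1}"
      and h: "hq + k1 * C1 + k2 * C2 \<le> hp"
      and \<gamma>\<delta>: "\<And>s. s \<in> ?I \<Longrightarrow> \<delta> s \<le> \<gamma> s + k1 * c1 s + k2 * c2 s"
    for p q P Q \<gamma> \<delta> :: "real \<Rightarrow> real" and hp hq k1 k2 t :: real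
  proof -
    obtain \<alpha> where \<alpha>: "\<alpha> \<in> borel_measurable (restrict_space borel ?I)"
        "\<forall>r\<in>?I. \<bar>\<alpha> r\<bar> \<le> L" "\<alpha> absolutely_integrable_on ?I"
      and formula: "\<And>t. t \<in> ?I \<Longrightarrow> (p t - q t) * exp (- integral {t..T} \<alpha>) =
        hp - hq + integral {t..T} (\<lambda>s. exp (- integral {s..T} \<alpha>) * (\<gamma> s - \<delta> s))"
      using backward_difference_formula[OF pq L] by blast
    define E where "E s = exp (- integral {s..T} \<alpha>)" for s
    note low = lower[OF t \<alpha>, folded E_def]
    have sub: "f absolutely_integrable_on {t..T}" if "f absolutely_integrable_on ?I" for f :: "real \<Rightarrow> real"
      using t by (intro set_integrable_subset[OF that]) auto
    have I: "(\<lambda>s. E s * f s) integrable_on {t..T}" if "f absolutely_integrable_on ?I" for f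
      by (intro ign absolutely_integrable_continuous_mult low sub that)
    have Ik: "(\<lambda>s. k1 * (E s * c1 s) + k2 * (E s * c2 s)) integrable_on {t..T}"
      by (intro integrable_add integrable_on_mult_right I c1_int c2_int)
    \<comment> \<open>By \<open>\<gamma>\<delta>\<close> the source is at least
      \<open>- (k1 * c1 s + k2 * c2 s)\<close>. Its integral weighted by \<open>E\<close> is at
      least \<open>- (k1 * C1 + k2 * C2)\<close> by \<open>low\<close>, and the gap between
      \<open>hp\<close> and \<open>hq\<close> makes up for this.\<close>
    have "integral {t..T} (\<lambda>s. k1 * (E s * c1 s) + k2 * (E s * c2 s)) =
        k1 * integral {t..T} (\<lambda>s. E s * c1 s) + k2 * integral {t..T} (\<lambda>s. E s * c2 s)"
      by (subst integral_add) (auto intro!: integrable_on_mult_right I c1_int c2_int)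
    also have "\<dots> \<le> k1 * C1 + k2 * C2"
      using low k by auto
    finally have "- (k1 * C1 + k2 * C2) \<le> integral {t..T} (\<lambda>s. - (k1 * (E s * c1 s) + k2 * (E s * c2 s)))"
      by (subst integral_neg) linarith
    also have "\<dots> \<le> integral {t..T} (\<lambda>s. E s * (\<gamma> s - \<delta> s))"
    proof (rule integral_le)
      show "(\<lambda>s. - (k1 * (E s * c1 s) + k2 * (E s * c2 s))) integrable_on {t..T}"
        by (intro integrable_neg Ik)
      show "(\<lambda>s. E s * (\<gamma> s - \<delta> s)) integrable_on {t..T}"
        by (intro I diff pq)
      fix s assume "s \<in> {t..T}"
      then have "E s * (- (k1 * c1 s + k2 * c2 s)) \<le> E s * (\<gamma> s - \<delta> s)"
        using \<gamma>\<delta>[of s] t by (intro mult_left_mono) (auto simp: E_def)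
      then show "- (k1 * (E s * c1 s) + k2 * (E s * c2 s)) \<le> E s * (\<gamma> s - \<delta> s)"
        by (simp add: algebra_simps)
    qed
    finally have "0 \<le> (p t - q t) * E t"
      using formula[OF t] h by (simp add: E_def)
    then show ?thesis
      by (simp add: E_def zero_le_mult_iff)
  qed

  \<comment> \<open>\<open>F2\<close> is taken as the driver of both equations; the defect
    \<open>F1 - F2\<close> at \<open>y1\<close>, which is nonpositive, is moved into
    \<open>\<delta>\<close> together with \<open>c1\<close>.\<close>
  have y12: "y1 t \<le> y2 t" if t: "t \<in> ?I" for t
  proof (rule compare[OF t])
    show "(\<lambda>s. F2 s (y2 s)) \<in> borel_measurable (restrict_space borel ?I)"
      "(\<lambda>s. F2 s (y1 s)) \<in> borel_measurable (restrict_space borel ?I)"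
      by (intro comp F2_meas y1 y2)+
    show "(\<lambda>s. - c2 s) absolutely_integrable_on ?I"
      using set_integrable_mult_right[OF c2_int, of "-1"] by simp
    show "(\<lambda>s. F1 s (y1 s) + c1 s - F2 s (y1 s)) absolutely_integrable_on ?I"
      by (intro diff y1 F21)
    show "\<bar>F2 s (y2 s) - F2 s (y1 s)\<bar> \<le> L * \<bar>y2 s - y1 s\<bar>" if "s \<in> ?I" for s
      using that by (intro lip) auto
    show "y2 t = h2 + C2 + integral {t..T} (\<lambda>s. F2 s (y2 s) + - c2 s)" if "t \<in> ?I" for t
      using y2(2)[OF that] by simp
    show "y1 t = h1 - C1 + integral {t..T} (\<lambda>s. F2 s (y1 s) + (F1 s (y1 s) + c1 s - F2 s (y1 s)))"
      if "t \<in> ?I" for t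
      using y1(2)[OF that] by simp
    show "F1 s (y1 s) + c1 s - F2 s (y1 s) \<le> - c2 s + 1 * c1 s + 1 * c2 s" if "s \<in> ?I" for s
      using F_le[OF that, of "y1 s"] by simp
  qed (use F21 F22 y1 y2 h_le in auto)

  \<comment> \<open>The projected driver and its solution\<close>
  define \<pi> where "\<pi> s x = max (y1 s) (min (y2 s) x)" for s x
  have \<pi>_seg: "\<pi> s x \<in> closed_segment (y1 s) (y2 s)" if "s \<in> ?I" for s x
    using y12[OF that] by (auto simp: \<pi>_def closed_segment_eq_real_ivl)
  have \<pi>_id: "\<pi> s x = x" if "y1 s \<le> x" "x \<le> y2 s" for s x
    using that by (auto simp: \<pi>_def)
  have \<pi>_cont: "continuous_on ?I (\<lambda>s. \<pi> s (y s))" if "continuous_on ?I y" for y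
    unfolding \<pi>_def by (intro continuous_intros y1 y2 that)
  have G_meas: "(\<lambda>s. F0 s (\<pi> s (y s))) \<in> borel_measurable (restrict_space borel ?I)"
    if "continuous_on ?I y" for y
    by (intro comp F0_meas \<pi>_cont that)
  \<comment> \<open>The projection is nonexpansive, so the Lipschitz bound on the segment becomes
    global.\<close>
  have G_lip: "\<bar>F0 s (\<pi> s x) - F0 s (\<pi> s y)\<bar> \<le> L * \<bar>x - y\<bar>" if "s \<in> ?I" for s x y
  proof -
    have "\<bar>F0 s (\<pi> s x) - F0 s (\<pi> s y)\<bar> \<le> L * \<bar>\<pi> s x - \<pi> s y\<bar>"
      using that by (intro lip \<pi>_seg) auto
    also have "\<dots> \<le> L * \<bar>x - y\<bar>"
      using L by (intro mult_left_mono) (auto simp: \<pi>_def)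
    finally show ?thesis .
  qed
  \<comment> \<open>At \<open>y1\<close> the driver \<open>F0\<close> lies between \<open>F1\<close>
    and \<open>F2\<close>, both integrable there; the Lipschitz bound controls the distance from
    \<open>y1\<close>.\<close>
  have G_int: "(\<lambda>s. F0 s (\<pi> s (y s))) absolutely_integrable_on ?I" if y: "continuous_on ?I y" for y
  proof (rule measurable_bounded_by_integrable_imp_absolutely_integrable)
    show "(\<lambda>s. F0 s (\<pi> s (y s))) \<in> borel_measurable (lebesgue_on ?I)"
      by (intro borel_measurable_lebesgue_on_if_borel G_meas y) auto
    show "(\<lambda>s. \<bar>F1 s (y1 s)\<bar> + \<bar>F2 s (y1 s)\<bar> + L * \<bar>\<pi> s (y s) - y1 s\<bar>) integrable_on ?I"
      by (intro integrable_add[OF integrable_add[OF norm_int[OF F11] norm_int[OF F21]]]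
          integrable_continuous_real continuous_intros y1 \<pi>_cont y)
    show "norm (F0 s (\<pi> s (y s))) \<le> \<bar>F1 s (y1 s)\<bar> + \<bar>F2 s (y1 s)\<bar> + L * \<bar>\<pi> s (y s) - y1 s\<bar>"
      if "s \<in> ?I" for s
      using lip[OF that _ \<pi>_seg[OF that, of "y s"], of F0 "y1 s"] F_le[OF that, of "y1 s"]
      by (simp, linarith)
  qed auto
  obtain y0 where y0_cont: "continuous_on ?I y0"
    and y0: "\<And>t. t \<in> ?I \<Longrightarrow> y0 t = h0 + integral {t..T} (\<lambda>s. F0 s (\<pi> s (y0 s)))"
    using backward_ode_exists_of_lipschitz[of 0 T "\<lambda>s x. F0 s (\<pi> s x)" L h0] G_lip G_int L T
    by auto
  have \<pi>_y: "\<pi> s (y1 s) = y1 s" "\<pi> s (y2 s) = y2 s" if "s \<in> ?I" for s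
    using y12[OF that] by (auto intro: \<pi>_id)

  \<comment> \<open>The common driver is the projected \<open>F0\<close>, which is globally
    Lipschitz, so no prior location of \<open>y0\<close> is needed. At \<open>y1\<close> the
    projection is the identity, and \<open>F1 \<le> F0\<close> applies.\<close>
  have y0_ge: "y1 t \<le> y0 t" if t: "t \<in> ?I" for t
  proof (rule compare[OF t, where \<gamma> = "\<lambda>_. 0"])
    show "(\<lambda>s. F0 s (\<pi> s (y0 s))) \<in> borel_measurable (restrict_space borel ?I)"
      "(\<lambda>s. F0 s (\<pi> s (y1 s))) \<in> borel_measurable (restrict_space borel ?I)"
      by (intro G_meas y0_cont y1)+
    show "(\<lambda>s. F0 s (\<pi> s (y0 s))) absolutely_integrable_on ?I"
      "(\<lambda>s. F0 s (\<pi> s (y1 s))) absolutely_integrable_on ?I"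
      by (intro G_int y0_cont y1)+
    show "(\<lambda>s. F1 s (y1 s) + c1 s - F0 s (\<pi> s (y1 s))) absolutely_integrable_on ?I"
      by (intro diff y1 G_int)
    show "y0 t = h0 + integral {t..T} (\<lambda>s. F0 s (\<pi> s (y0 s)) + 0)" if "t \<in> ?I" for t
      using y0[OF that] by simp
    show "y1 t = h1 - C1 + integral {t..T} (\<lambda>s. F0 s (\<pi> s (y1 s)) + (F1 s (y1 s) + c1 s - F0 s (\<pi> s (y1 s))))"
      if "t \<in> ?I" for t
      using y1(2)[OF that] by simp
    show "F1 s (y1 s) + c1 s - F0 s (\<pi> s (y1 s)) \<le> 0 + 1 * c1 s + 0 * c2 s" if "s \<in> ?I" for s
      using F_le[OF that, of "y1 s"] by (simp add: \<pi>_y[OF that])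
  qed (use G_lip y1 y0_cont h_le in auto)

  \<comment> \<open>Mirror image: the nonnegative defect \<open>F2 - F0\<close> at \<open>y2\<close>
    enters \<open>\<gamma>\<close> together with \<open>- c2\<close>.\<close>
  have y0_le: "y0 t \<le> y2 t" if t: "t \<in> ?I" for t
  proof (rule compare[OF t, where \<delta> = "\<lambda>_. 0"])
    show "(\<lambda>s. F0 s (\<pi> s (y2 s))) \<in> borel_measurable (restrict_space borel ?I)"
      "(\<lambda>s. F0 s (\<pi> s (y0 s))) \<in> borel_measurable (restrict_space borel ?I)"
      by (intro G_meas y0_cont y2)+
    show "(\<lambda>s. F0 s (\<pi> s (y2 s))) absolutely_integrable_on ?I"
      "(\<lambda>s. F0 s (\<pi> s (y0 s))) absolutely_integrable_on ?I"
      by (intro G_int y0_cont y2)+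
    show "(\<lambda>s. F2 s (y2 s) - c2 s - F0 s (\<pi> s (y2 s))) absolutely_integrable_on ?I"
      by (intro diff y2 G_int)
    show "y0 t = h0 + integral {t..T} (\<lambda>s. F0 s (\<pi> s (y0 s)) + 0)" if "t \<in> ?I" for t
      using y0[OF that] by simp
    show "y2 t = h2 + C2 + integral {t..T} (\<lambda>s. F0 s (\<pi> s (y2 s)) + (F2 s (y2 s) - c2 s - F0 s (\<pi> s (y2 s))))"
      if "t \<in> ?I" for t
      using y2(2)[OF that] by simp
    show "0 \<le> F2 s (y2 s) - c2 s - F0 s (\<pi> s (y2 s)) + 0 * c1 s + 1 * c2 s" if "s \<in> ?I" for s
      using F_le[OF that, of "y2 s"] by (simp add: \<pi>_y[OF that])
  qed (use G_lip y2 y0_cont h_le in auto)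

  have sol: "backward_ode_solution T h0 F0 y0"
  proof -
    have eq: "F0 s (\<pi> s (y0 s)) = F0 s (y0 s)" if "s \<in> ?I" for s
      using \<pi>_id[OF y0_ge y0_le] that by simp
    have "(\<lambda>s. F0 s (y0 s)) absolutely_integrable_on ?I"
      using G_int[OF y0_cont]
      by (subst set_integrable_cong[OF refl refl eq[symmetric]]) auto
    moreover have "integral {t..T} (\<lambda>s. F0 s (y0 s)) = integral {t..T} (\<lambda>s. F0 s (\<pi> s (y0 s)))"
      if "t \<in> ?I" for t
      using that by (intro integral_cong) (simp add: eq)
    ultimately show ?thesis
      using y0 by (subst backward_ode_solution_iff_integral) auto
  qed
  \<comment> \<open>Lying between \<open>y1\<close> and \<open>y2\<close> puts \<open>z\<close> and
    \<open>w\<close> where \<open>F0\<close> itself is Lipschitz. Exchanging them gives the reverse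
    inequality, hence equality.\<close>
  have unique: "z t \<le> w t"
    if t: "t \<in> ?I"
      and z: "backward_ode_solution T h0 F0 z" "\<forall>t\<in>?I. y1 t \<le> z t \<and> z t \<le> y2 t"
      and w: "backward_ode_solution T h0 F0 w" "\<forall>t\<in>?I. y1 t \<le> w t \<and> w t \<le> y2 t"
    for z w t
  proof (rule compare[OF t, where \<gamma> = "\<lambda>_. 0" and \<delta> = "\<lambda>_. 0"])
    note zD = backward_ode_solutionD[OF z(1)] and wD = backward_ode_solutionD[OF w(1)]
    show "(\<lambda>s. F0 s (w s)) \<in> borel_measurable (restrict_space borel ?I)"
      "(\<lambda>s. F0 s (z s)) \<in> borel_measurable (restrict_space borel ?I)"
      by (intro comp F0_meas zD wD)+
    show "(\<lambda>s. F0 s (w s)) absolutely_integrable_on ?I" "(\<lambda>s. F0 s (z s)) absolutely_integrable_on ?I"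
      "continuous_on ?I w" "continuous_on ?I z"
      by (intro zD wD)+
    show "\<bar>F0 s (w s) - F0 s (z s)\<bar> \<le> L * \<bar>w s - z s\<bar>" if "s \<in> ?I" for s
      using that z(2) w(2) y12[OF that] by (intro lip) (auto simp: closed_segment_eq_real_ivl)
    show "w t = h0 + integral {t..T} (\<lambda>s. F0 s (w s) + 0)"
      "z t = h0 + integral {t..T} (\<lambda>s. F0 s (z s) + 0)" if "t \<in> ?I" for t
      using zD(2)[OF that] wD(2)[OF that] by auto
    show "h0 + 0 * C1 + 0 * C2 \<le> h0" "0 \<le> 0 + 0 * c1 s + 0 * c2 s" for s
      by auto
  qed auto
  show ?thesis
    using sol y0_ge y0_le unique by (intro exI[of _ y0]) (auto intro!: antisym)
qed

end
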